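(* Let $f=[xy,\;xy-2z^2,\;yz+3z^2]$, a birational map of $\mathbb{P}^2$ defined over $\mathbb{Z}$. For every prime $p>2$, the reduction $f_p$ of $f$ modulo $p$ is a birational map of $\mathbb{P}^2(\overline{\mathbb{F}_p})$, and $\lambda_1(f_p)<2$.
   Context: $f_p$ is obtained by reducing the coefficients of the defining polynomials of $f$ modulo $p$. For a birational map $g$ of $\mathbb{P}^2$ over an algebraically closed field, $\deg(g)$ is the common degree of homogeneous polynomials without common factor defining $g$, and $\lambda_1(g)=\lim_{n\to\infty}\deg(g^n)^{1/n}$ is its first dynamical degree. *)

theory Defs
  imports
    "HOL-Analysis.Analysis"
    "HOL-Algebra.Algebraic_Closure_Type"
    "Berlekamp_Zassenhaus.Finite_Field"
begin

hide_const (open) UnivPoly.up_ring.coeff UnivPoly.up_ring.monom Divisibility.prime Divisibility.irreducible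

text \<open>
  A polynomial in $x, y, z$ over a ring is an iterated univariate polynomial: the outermost variable
  is $x$, the innermost one is $z$, so \<open>coeff (coeff (coeff F i) j) k\<close> is the coefficient of
  $x^i y^j z^k$ in \<open>F\<close>.
\<close>

type_synonym 'a poly3 = "'a poly poly poly"

definition const3 :: "'a::comm_ring_1 \<Rightarrow> 'a poly3" where
  "const3 c = [:[:[:c:]:]:]"

definition var_x :: "'a::comm_ring_1 poly3" where
  "var_x = [:0, 1:]"

definition var_y :: "'a::comm_ring_1 poly3" where
  "var_y = [:[:0, 1:]:]"

definition var_z :: "'a::comm_ring_1 poly3" where
  "var_z = [:[:[:0, 1:]:]:]"

definition homogeneous :: "nat \<Rightarrow> 'a::comm_ring_1 poly3 \<Rightarrow> bool" where
  "homogeneous d F \<longleftrightarrow> (\<forall>i j k. coeff (coeff (coeff F i) j) k \<noteq> 0 \<longrightarrow> i + j + k = d)"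

text \<open>\<open>subst3 F A B C\<close> is $F(A, B, C)$.\<close>

definition subst3 ::
    "'a::comm_ring_1 poly3 \<Rightarrow> 'a poly3 \<Rightarrow> 'a poly3 \<Rightarrow> 'a poly3 \<Rightarrow> 'a poly3" where
  "subst3 F A B C =
     poly (map_poly (\<lambda>q. poly (map_poly (\<lambda>r. poly (map_poly const3 r) C) q) B) F) A"

text \<open>
  A rational self-map $[F_0, F_1, F_2]$ of the projective plane is handled through the triples
  representing it: homogeneous polynomials of a common degree, not all zero, possibly with a common
  factor. Two such triples represent the same map iff they are proportional over the function field,
  which is \<open>same_map\<close>.
\<close>

type_synonym 'a triple = "'a poly3 \<times> 'a poly3 \<times> 'a poly3"

fun homogeneous_triple :: "nat \<Rightarrow> 'a::comm_ring_1 triple \<Rightarrow> bool" where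
  "homogeneous_triple d (F0, F1, F2) \<longleftrightarrow>
     homogeneous d F0 \<and> homogeneous d F1 \<and> homogeneous d F2 \<and> (F0, F1, F2) \<noteq> (0, 0, 0)"

definition rational_map :: "'a::comm_ring_1 triple \<Rightarrow> bool" where
  "rational_map F \<longleftrightarrow> (\<exists>d. homogeneous_triple d F)"

fun same_map :: "'a::comm_ring_1 triple \<Rightarrow> 'a triple \<Rightarrow> bool" where
  "same_map (F0, F1, F2) (G0, G1, G2) \<longleftrightarrow>
     F0 * G1 = F1 * G0 \<and> F0 * G2 = F2 * G0 \<and> F1 * G2 = F2 * G1"

fun no_common_factor :: "'a::idom triple \<Rightarrow> bool" where
  "no_common_factor (F0, F1, F2) \<longleftrightarrow> (\<forall>D. D dvd F0 \<and> D dvd F1 \<and> D dvd F2 \<longrightarrow> D dvd 1)"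

definition id_map :: "'a::comm_ring_1 triple" where
  "id_map = (var_x, var_y, var_z)"

text \<open>
  The substituted triple represents the composite $F \circ G$ as soon as it is not $(0, 0, 0)$; this is
  automatic if \<open>G\<close> is dominant, in particular for the iterates of a birational map.
\<close>

fun comp_map :: "'a::comm_ring_1 triple \<Rightarrow> 'a triple \<Rightarrow> 'a triple" where
  "comp_map (F0, F1, F2) (G0, G1, G2) =
     (subst3 F0 G0 G1 G2, subst3 F1 G0 G1 G2, subst3 F2 G0 G1 G2)"

definition birational_map :: "'a::field triple \<Rightarrow> bool" where
  "birational_map F \<longleftrightarrow> rational_map F \<and>
     (\<exists>G. rational_map G \<and>
          rational_map (comp_map F G) \<and> same_map (comp_map F G) id_map \<and>
          rational_map (comp_map G F) \<and> same_map (comp_map G F) id_map)"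

definition deg_map :: "'a::field triple \<Rightarrow> nat" where
  "deg_map F = (THE d. \<exists>G. homogeneous_triple d G \<and> no_common_factor G \<and> same_map G F)"

definition iter_map :: "nat \<Rightarrow> 'a::field triple \<Rightarrow> 'a triple" where
  "iter_map n F = (comp_map F ^^ n) id_map"

definition deg_growth :: "'a::field triple \<Rightarrow> nat \<Rightarrow> real" where
  "deg_growth F n = real (deg_map (iter_map n F)) powr (1 / real n)"

definition dynamical_degree :: "'a::field triple \<Rightarrow> real" where
  "dynamical_degree F = lim (deg_growth F)"

text \<open>
  Base change of a triple with integer coefficients to a ring. For a field of characteristic $p$ this
  is reduction modulo $p$ followed by the inclusion of the prime field.
\<close>

definition base_change3 :: "int poly3 \<Rightarrow> 'a::comm_ring_1 poly3" where
  "base_change3 = map_poly (map_poly (map_poly of_int))"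

fun base_change :: "int triple \<Rightarrow> 'a::comm_ring_1 triple" where
  "base_change (F0, F1, F2) = (base_change3 F0, base_change3 F1, base_change3 F2)"

definition f_map :: "int triple" where
  "f_map = (var_x * var_y, var_x * var_y - 2 * var_z ^ 2, var_y * var_z + 3 * var_z ^ 2)"

text \<open>
  The field with $p$ elements is \<open>'p mod_ring\<close> for a type \<open>'p\<close> of prime cardinality $p$, and its
  algebraic closure is \<open>'p mod_ring alg_closure\<close>.
\<close>

definition f_red :: "'p::prime_card itself \<Rightarrow> 'p mod_ring alg_closure triple" where
  "f_red _ = base_change f_map"

end

theory Submission
  imports Defs
begin

text \<open>
  Write $f^n = [x_n, y_n, z_n]$ for the triple obtained by iterated substitution; it has degree $2^n$.
  The degree of \<open>f\<close> drops below $2^n$ as soon as these three polynomials have a common factor.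

  In characteristic \<open>p\<close> the factor is \<open>y\<close>, for the following reason. The line $y = 0$ is contracted
  by \<open>f\<close> to the point $[0 : -2 : 3]$ of the line $x = 0$. That line is invariant, and \<open>f\<close> acts on it
  by the Moebius map with matrix $(0, -2; 1, 3)$, whose eigenvalues are 1 and 2. In
  characteristic zero this map has infinite order; modulo \<open>p\<close> its order divides $p - 1$ by Fermat.
  As it sends the indeterminacy point $[0 : 1 : 0]$ to $[0 : 0 : 1]$ and the latter to
  $[0 : -2 : 3]$, the image of the line $y = 0$ eventually reaches
  $[0 : 1 : 0]$. Algebraically: modulo \<open>y\<close> one has
  $[x_n, y_n, z_n] = [0, -2 (2^n - 1) C, (2^{n+1} - 1) C]$ for $n \ge 1$ and some polynomial \<open>C\<close>
  (\<open>iter_map_f_mod_y\<close>), so $y$ divides $z_{p-2}$ because $2^{p-1} = 1$, and one step later it divides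
  all three components. Hence $\deg(f^{p-1}) < 2^{p-1}$ (\<open>deg_map_iter_f_less\<close>).

  The degree is submultiplicative along the iterates (\<open>deg_map_comp_le\<close>), so by Fekete's lemma the
  limit defining the dynamical degree exists and is at most $\deg(f^{p-1})^{1/(p-1)} < 2$
  (\<open>dynamical_degree_f_less_2\<close>). No iterate degenerates to the zero triple, because
  $[1 : 1 : 0]$ is a fixed point of \<open>f\<close> at which \<open>f\<close> is defined.

  Two facts from commutative algebra make degrees meaningful: factors of homogeneous polynomials are
  homogeneous (\<open>homogeneous_factors\<close>), which allows one to cancel a common factor, and polynomial
  rings over a field have greatest common divisors, which makes the reduced triple unique up to a unit
  (\<open>reduced_degree_unique\<close>). Birationality is an explicit computation with the inverse
  \<open>f_inverse\<close>, valid over every field in which 2 is invertible.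
\<close>

section \<open>Evaluation homomorphisms on polynomials in three variables\<close>

lemma comm_ring_hom_compose:
  assumes "comm_ring_hom f" and "comm_ring_hom g"
  shows "comm_ring_hom (\<lambda>x. f (g x))"
proof -
  interpret f: comm_ring_hom f by fact
  interpret g: comm_ring_hom g by fact
  show ?thesis by unfold_locales (simp_all add: f.hom_add f.hom_mult g.hom_add g.hom_mult)
qed

lemma comm_ring_hom_const_poly: "comm_ring_hom (\<lambda>c :: 'a :: comm_ring_1. [:c:])"
  by unfold_locales (simp_all add: one_pCons)

lemma comm_ring_hom_const3: "comm_ring_hom const3"
  unfolding const3_def
  by (rule comm_ring_hom_compose[OF comm_ring_hom_const_poly
        comm_ring_hom_compose[OF comm_ring_hom_const_poly comm_ring_hom_const_poly]])

lemma comm_ring_hom_poly_map_poly: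
  fixes h :: "'a :: comm_ring_1 \<Rightarrow> 'b :: comm_ring_1"
  assumes "comm_ring_hom h"
  shows "comm_ring_hom (\<lambda>F. poly (map_poly h F) a)"
proof -
  interpret h: comm_ring_hom h by fact
  interpret mp: map_poly_comm_ring_hom h ..
  show ?thesis by unfold_locales (simp_all add: mp.hom_add mp.hom_mult)
qed

lemma poly_map_poly_pCons:
  fixes h :: "'a :: comm_ring_1 \<Rightarrow> 'b :: comm_ring_1"
  assumes "comm_ring_hom h"
  shows "poly (map_poly h (pCons c F)) a = h c + a * poly (map_poly h F) a"
proof -
  interpret h: comm_ring_hom h by fact
  show ?thesis by (simp add: h.map_poly_pCons_hom)
qed

lemma poly_hom_eqI:
  fixes \<phi> \<psi> :: "'a :: comm_ring_1 poly \<Rightarrow> 'b :: comm_ring_1"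
  assumes "comm_ring_hom \<phi>" and "comm_ring_hom \<psi>"
    and const: "\<And>c. \<phi> [:c:] = \<psi> [:c:]" and var: "\<phi> [:0, 1:] = \<psi> [:0, 1:]"
  shows "\<phi> F = \<psi> F"
proof (induction F)
  case 0
  interpret \<phi>: comm_ring_hom \<phi> by fact
  interpret \<psi>: comm_ring_hom \<psi> by fact
  show ?case by simp
next
  case (pCons c F)
  interpret \<phi>: comm_ring_hom \<phi> by fact
  interpret \<psi>: comm_ring_hom \<psi> by fact
  have "pCons c F = [:c:] + [:0, 1:] * F" by simp
  then show ?case
    by (metis \<phi>.hom_add \<phi>.hom_mult \<psi>.hom_add \<psi>.hom_mult const var pCons.IH)
qed

text \<open>
  A ring homomorphism on the polynomial ring is determined by constants and variables. This is
  how identities between substitutions are proved below.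
\<close>

lemma poly3_hom_eqI:
  fixes \<phi> \<psi> :: "'a :: comm_ring_1 poly3 \<Rightarrow> 'b :: comm_ring_1"
  assumes homs: "comm_ring_hom \<phi>" "comm_ring_hom \<psi>"
    and const: "\<And>c. \<phi> (const3 c) = \<psi> (const3 c)"
    and vars: "\<phi> var_x = \<psi> var_x" "\<phi> var_y = \<psi> var_y" "\<phi> var_z = \<psi> var_z"
  shows "\<phi> F = \<psi> F"
proof -
  have homs2: "comm_ring_hom (\<lambda>q. \<phi> [:q:])" "comm_ring_hom (\<lambda>q. \<psi> [:q:])"
    using homs by (auto intro: comm_ring_hom_compose[OF _ comm_ring_hom_const_poly])
  have homs1: "comm_ring_hom (\<lambda>r. \<phi> [:[:r:]:])" "comm_ring_hom (\<lambda>r. \<psi> [:[:r:]:])"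
    using homs2 by (auto intro: comm_ring_hom_compose[OF _ comm_ring_hom_const_poly])
  have "\<phi> [:[:r:]:] = \<psi> [:[:r:]:]" for r
    using poly_hom_eqI[OF homs1, of r] const vars(3) by (simp add: const3_def var_z_def)
  then have "\<phi> [:q:] = \<psi> [:q:]" for q
    using poly_hom_eqI[OF homs2, of q] vars(2) by (simp add: var_y_def)
  then show ?thesis
    using poly_hom_eqI[OF homs, of F] vars(1) by (simp add: var_x_def)
qed

text \<open>
  The same nested Horner scheme as \<open>subst3\<close>, but with values in an arbitrary ring: this covers
  substitution, evaluation at a point, and the grading homomorphism uniformly.
\<close>

definition eval3 ::
    "('a::comm_ring_1 \<Rightarrow> 'b::comm_ring_1) \<Rightarrow> 'b \<Rightarrow> 'b \<Rightarrow> 'b \<Rightarrow> 'a poly3 \<Rightarrow> 'b" where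
  "eval3 h a b c F =
     poly (map_poly (\<lambda>q. poly (map_poly (\<lambda>r. poly (map_poly h r) c) q) b) F) a"

lemma subst3_eq_eval3: "subst3 F A B C = eval3 const3 A B C F"
  by (simp add: subst3_def eval3_def)

lemma comm_ring_hom_eval3:
  assumes "comm_ring_hom h"
  shows "comm_ring_hom (eval3 h a b c)"
  unfolding eval3_def using assms by (intro comm_ring_hom_poly_map_poly)

lemma eval3_const_var:
  assumes "comm_ring_hom h"
  shows "eval3 h a b c (const3 k) = h k"
    and "eval3 h a b c var_x = a"
    and "eval3 h a b c var_y = b"
    and "eval3 h a b c var_z = c"
proof -
  note h1 = comm_ring_hom_poly_map_poly[OF assms, of c]
  note h2 = comm_ring_hom_poly_map_poly[OF h1, of b]
  interpret h: comm_ring_hom h by fact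
  interpret h1: comm_ring_hom "\<lambda>r. poly (map_poly h r) c" by (fact h1)
  interpret h2: comm_ring_hom "\<lambda>q. poly (map_poly (\<lambda>r. poly (map_poly h r) c) q) b" by (fact h2)
  show "eval3 h a b c (const3 k) = h k"
    by (simp add: eval3_def const3_def poly_map_poly_pCons assms h1 h2)
  show "eval3 h a b c var_x = a"
    using h2.hom_one by (simp add: eval3_def var_x_def poly_map_poly_pCons assms h1 h2)
  show "eval3 h a b c var_y = b"
    using h1.hom_one by (simp add: eval3_def var_y_def poly_map_poly_pCons assms h1 h2)
  show "eval3 h a b c var_z = c"
    by (simp add: eval3_def var_z_def poly_map_poly_pCons assms h1 h2)
qed

lemma eval3_unique:
  assumes "comm_ring_hom \<phi>" and "comm_ring_hom h"
    and "\<And>c. \<phi> (const3 c) = h c"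
  shows "\<phi> F = eval3 h (\<phi> var_x) (\<phi> var_y) (\<phi> var_z) F"
  by (rule poly3_hom_eqI[OF assms(1) comm_ring_hom_eval3[OF assms(2)]])
    (simp_all add: eval3_const_var assms)

lemma hom_subst3:
  assumes "comm_ring_hom \<phi>"
  shows "\<phi> (subst3 F A B C) = eval3 (\<lambda>c. \<phi> (const3 c)) (\<phi> A) (\<phi> B) (\<phi> C) F"
proof -
  have c: "comm_ring_hom (\<lambda>c. \<phi> (const3 c))"
    by (rule comm_ring_hom_compose[OF assms comm_ring_hom_const3])
  have "comm_ring_hom (\<lambda>F. \<phi> (subst3 F A B C))"
    unfolding subst3_eq_eval3
    by (rule comm_ring_hom_compose[OF assms comm_ring_hom_eval3[OF comm_ring_hom_const3]])
  from eval3_unique[OF this c, of F] show ?thesis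
    by (simp add: subst3_eq_eval3 eval3_const_var comm_ring_hom_const3)
qed

section \<open>Homogeneity as a monomial condition on the grading homomorphism\<close>

text \<open>
  The substitution $F(t x, t y, t z)$, as a polynomial in a new variable \<open>t\<close>. Its coefficient at
  $t^n$ is the homogeneous component of degree \<open>n\<close>, so that homogeneity turns into the statement that
  this image is a monomial in \<open>t\<close>. Closure properties of homogeneous polynomials then follow from
  the multiplicativity of \<open>grade\<close>.
\<close>

definition grade :: "'a::comm_ring_1 poly3 \<Rightarrow> 'a poly3 poly" where
  "grade = eval3 (\<lambda>c. [:const3 c:]) (monom var_x 1) (monom var_y 1) (monom var_z 1)"

lemma comm_ring_hom_const_const3: "comm_ring_hom (\<lambda>c. [:const3 c:])"
  by (rule comm_ring_hom_compose[OF comm_ring_hom_const_poly comm_ring_hom_const3])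

lemma comm_ring_hom_grade: "comm_ring_hom grade"
  unfolding grade_def by (rule comm_ring_hom_eval3[OF comm_ring_hom_const_const3])

lemma coeff_monom_1_mult:
  "coeff (monom c (Suc 0) * P) n = (case n of 0 \<Rightarrow> 0 | Suc m \<Rightarrow> c * coeff P m)"
  by (cases n) (simp_all add: coeff_monom_mult)

lemma coeff_var_mult:
  "coeff (var_x * P) i = (case i of 0 \<Rightarrow> 0 | Suc i' \<Rightarrow> coeff P i')"
  "coeff (coeff (var_y * P) i) j = (case j of 0 \<Rightarrow> 0 | Suc j' \<Rightarrow> coeff (coeff P i) j')"
  "coeff (coeff (coeff (var_z * P) i) j) k =
     (case k of 0 \<Rightarrow> 0 | Suc k' \<Rightarrow> coeff (coeff (coeff P i) j) k')"
  by (simp_all add: var_x_def var_y_def var_z_def coeff_pCons)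

lemma coeff_grade:
  fixes F :: "'a :: comm_ring_1 poly3"
  shows "coeff (coeff (coeff (coeff (grade F) n) i) j) k =
           (if i + j + k = n then coeff (coeff (coeff F i) j) k else 0)"
proof -
  let ?h = "\<lambda>c :: 'a. [:const3 c:]"
  define g1 where "g1 = (\<lambda>r. poly (map_poly ?h r) (monom var_z 1))"
  define g2 where "g2 = (\<lambda>q. poly (map_poly g1 q) (monom var_y 1))"
  have g1: "comm_ring_hom g1" and g2: "comm_ring_hom g2"
    unfolding g1_def g2_def
    by (intro comm_ring_hom_poly_map_poly comm_ring_hom_const_const3)+
  have grade: "grade F = poly (map_poly g2 F) (monom var_x 1)" for F
    by (simp add: grade_def eval3_def g1_def g2_def)
  interpret g1: comm_ring_hom g1 by fact
  interpret g2: comm_ring_hom g2 by fact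
  have 1: "coeff (coeff (coeff (coeff (g1 r) n) i) j) k =
      (if i = 0 \<and> j = 0 \<and> k = n then coeff r k else 0)" for r n i j k
  proof (induction r arbitrary: n i j k)
    case (pCons c r)
    have "g1 (pCons c r) = [:const3 c:] + monom var_z 1 * g1 r"
      by (simp add: g1_def poly_map_poly_pCons comm_ring_hom_const_const3)
    then show ?case
      by (cases n; cases k) (auto simp: pCons.IH coeff_monom_1_mult coeff_var_mult const3_def
          coeff_pCons split: nat.split)
  qed simp
  have 2: "coeff (coeff (coeff (coeff (g2 q) n) i) j) k =
      (if i = 0 \<and> j + k = n then coeff (coeff q j) k else 0)" for q n i j k
  proof (induction q arbitrary: n i j k)
    case (pCons c q)
    have "g2 (pCons c q) = g1 c + monom var_y 1 * g2 q"
      by (simp add: g2_def poly_map_poly_pCons g1)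
    then show ?case
      by (cases n; cases j) (auto simp: pCons.IH 1 coeff_monom_1_mult coeff_var_mult)
  qed simp
  show ?thesis
  proof (induction F arbitrary: n i j k)
    case 0
    show ?case by (simp add: grade)
  next
    case (pCons c F)
    have "grade (pCons c F) = g2 c + monom var_x 1 * grade F"
      by (simp add: grade poly_map_poly_pCons g2)
    then show ?case
      by (cases n; cases i) (auto simp: pCons.IH 2 coeff_monom_1_mult coeff_var_mult)
  qed
qed

text \<open>
  The coefficient \<open>G\<close> is left arbitrary because factoring \<open>grade F\<close> only yields that the factors are
  monomials, without identifying their coefficients.
\<close>

lemma grade_eq_monomD:
  assumes "grade F = monom G d"
  shows "homogeneous d F"
  unfolding homogeneous_def
proof (intro allI impI)
  fix i j k assume "coeff (coeff (coeff F i) j) k \<noteq> 0"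
  then have "coeff (coeff (coeff (coeff (grade F) (i + j + k)) i) j) k \<noteq> 0"
    by (simp add: coeff_grade)
  then show "i + j + k = d" by (auto simp: assms split: if_splits)
qed

lemma homogeneous_iff_grade: "homogeneous d F \<longleftrightarrow> grade F = monom F d"
proof
  show "grade F = monom F d" if "homogeneous d F"
    using that by (intro poly_eqI) (auto simp: coeff_grade homogeneous_def)
next
  assume "grade F = monom F d"
  then show "homogeneous d F" by (rule grade_eq_monomD)
qed

interpretation grade: comm_ring_hom grade by (rule comm_ring_hom_grade)

lemma grade_const3: "grade (const3 c) = [:const3 c:]"
  and grade_var: "grade var_x = monom var_x 1" "grade var_y = monom var_y 1"
    "grade var_z = monom var_z 1"
  by (simp_all add: grade_def eval3_const_var comm_ring_hom_const_const3)

lemma homogeneous_var: "homogeneous 1 var_x" "homogeneous 1 var_y" "homogeneous 1 var_z"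
  unfolding homogeneous_iff_grade by (simp_all add: grade_var)

lemma homogeneous_0 [simp]: "homogeneous d 0"
  by (simp add: homogeneous_def)

lemma homogeneous_add: "homogeneous d F \<Longrightarrow> homogeneous d G \<Longrightarrow> homogeneous d (F + G)"
  by (simp add: homogeneous_iff_grade grade.hom_add add_monom)

lemma homogeneous_diff: "homogeneous d F \<Longrightarrow> homogeneous d G \<Longrightarrow> homogeneous d (F - G)"
  by (simp add: homogeneous_iff_grade grade.hom_minus diff_monom)

lemma homogeneous_mult:
  "homogeneous d F \<Longrightarrow> homogeneous e G \<Longrightarrow> homogeneous (d + e) (F * G)"
  by (simp add: homogeneous_iff_grade grade.hom_mult mult_monom)

lemma homogeneous_power: "homogeneous d F \<Longrightarrow> homogeneous (n * d) (F ^ n)"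
  by (simp add: homogeneous_iff_grade grade.hom_power monom_power mult.commute)

lemma homogeneous_numeral: "homogeneous 0 (numeral n)"
  unfolding homogeneous_iff_grade grade.hom_numeral monom_0 by (rule numeral_poly)

lemma homogeneous_degree_unique:
  "homogeneous d F \<Longrightarrow> homogeneous e F \<Longrightarrow> F \<noteq> 0 \<Longrightarrow> d = e"
  by (metis homogeneous_iff_grade monom_eq_iff')

lemma homogeneous_0_imp_const3:
  assumes "homogeneous 0 F"
  shows "F = const3 (coeff (coeff (coeff F 0) 0) 0)"
  using assms unfolding homogeneous_def const3_def
  by (intro poly_eqI) (force simp: coeff_pCons split: nat.split)

lemma homogeneous_0_dvd_1:
  fixes F :: "'a :: field poly3"
  assumes "homogeneous 0 F" and "F \<noteq> 0"
  shows "F dvd 1"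
proof -
  obtain c where c: "F = const3 c" using homogeneous_0_imp_const3[OF assms(1)] by blast
  with assms(2) have "c \<noteq> 0" by (auto simp: const3_def)
  then show ?thesis by (simp add: c const3_def is_unit_const_poly_iff)
qed

text \<open>
  The variable is a prime element, so it can be cancelled one power at a time.
\<close>

lemma mult_eq_monomD:
  fixes P Q :: "'a :: idom poly"
  assumes "P * Q = monom c d" and "c \<noteq> 0"
  shows "\<exists>a m b n. P = monom a m \<and> Q = monom b n \<and> m + n = d"
  using assms
proof (induction d arbitrary: P Q)
  case 0
  then have "P \<noteq> 0" "Q \<noteq> 0" by auto
  with 0 have "Polynomial.degree P + Polynomial.degree Q = 0" by (metis degree_mult_eq degree_monom_eq)
  then show ?case
    by (metis add_eq_0_iff_both_eq_0 degree_eq_zeroE monom_0 add_0)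
next
  case (Suc d)
  have *: "\<exists>a m b n. P = monom a m \<and> Q = monom b n \<and> m + n = Suc d"
    if PQ: "P * Q = monom c (Suc d)" "coeff P 0 = 0" for P Q
  proof -
    obtain P' where P': "P = pCons 0 P'" using PQ(2) by (cases P) auto
    have "P' * Q = monom c d" using PQ(1) by (simp add: P' monom_Suc)
    from Suc.IH[OF this Suc.prems(2)] obtain a m b n
      where "P' = monom a m" "Q = monom b n" "m + n = d" by blast
    then show ?thesis
      by (intro exI[of _ a] exI[of _ "Suc m"] exI[of _ b] exI[of _ n]) (simp add: P' monom_Suc)
  qed
  have "coeff P 0 * coeff Q 0 = 0"
    using arg_cong[OF Suc.prems(1), of "\<lambda>R. coeff R 0"] by (simp add: coeff_mult)
  then consider "coeff P 0 = 0" | "coeff Q 0 = 0" by auto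
  then show ?case
  proof cases
    case 1 then show ?thesis using *[OF Suc.prems(1)] by blast
  next
    case 2 then show ?thesis using *[of Q P] Suc.prems(1) by (metis mult.commute add.commute)
  qed
qed

text \<open>
  The two factors of \<open>grade (A * B)\<close>, a monomial over an integral domain, are monomials.
\<close>

lemma homogeneous_factors:
  fixes A B :: "'a :: idom poly3"
  assumes "homogeneous d (A * B)" and "A * B \<noteq> 0"
  shows "\<exists>a b. homogeneous a A \<and> homogeneous b B \<and> a + b = d"
proof -
  have "grade A * grade B = monom (A * B) d"
    using assms(1) by (simp add: homogeneous_iff_grade grade.hom_mult)
  from mult_eq_monomD[OF this assms(2)] show ?thesis
    using grade_eq_monomD by blast
qed

lemma homogeneous_unit:
  fixes U :: "'a :: idom poly3"
  assumes "U dvd 1"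
  shows "homogeneous 0 U"
proof -
  obtain V where V: "1 = U * V" using assms by (auto elim: dvdE)
  have "homogeneous 0 (1 :: 'a poly3)"
    unfolding homogeneous_iff_grade grade.hom_one monom_0 by (rule one_pCons)
  with homogeneous_factors[of 0 U V] V show ?thesis by auto
qed

text \<open>
  Euler's scaling rule $F(s a, s b, s c) = s^d F(a, b, c)$: specialise $t = s$ in \<open>grade F\<close>.
\<close>

lemma eval3_scale:
  assumes "homogeneous d F" and h: "comm_ring_hom h"
  shows "eval3 h (s * a) (s * b) (s * c) F = s ^ d * eval3 h a b c F"
proof -
  \<comment> \<open>The specialisation of \<open>t\<close> to \<open>s\<close> and of the original variables to \<open>a\<close>, \<open>b\<close>, \<open>c\<close>.\<close>
  define \<psi> where "\<psi> = (\<lambda>P. poly (map_poly (eval3 h a b c) P) s)"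
  note ev = comm_ring_hom_eval3[OF h, of a b c]
  have \<psi>: "comm_ring_hom \<psi>"
    unfolding \<psi>_def by (rule comm_ring_hom_poly_map_poly[OF ev])
  interpret ev: comm_ring_hom "eval3 h a b c" by (fact ev)
  have \<psi>_monom: "\<psi> (monom G n) = s ^ n * eval3 h a b c G" for G n
    by (simp add: \<psi>_def ev.map_poly_hom_monom poly_monom)
  have "\<psi> (grade (const3 k)) = h k" for k
    using \<psi>_monom[of "const3 k" 0] by (simp add: grade_const3 monom_0 eval3_const_var h)
  from eval3_unique[OF comm_ring_hom_compose[OF \<psi> comm_ring_hom_grade] h this, of F]
  have "\<psi> (grade F) = eval3 h (s * a) (s * b) (s * c) F"
    by (simp add: grade_var \<psi>_monom eval3_const_var h)
  moreover have "\<psi> (grade F) = s ^ d * eval3 h a b c F"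
    using assms(1) by (simp add: homogeneous_iff_grade \<psi>_monom)
  ultimately show ?thesis by simp
qed

lemma homogeneous_subst3:
  assumes F: "homogeneous d F"
    and "homogeneous e A" "homogeneous e B" "homogeneous e C"
  shows "homogeneous (d * e) (subst3 F A B C)"
proof -
  have m: "grade G = monom 1 e * [:G:]" if "homogeneous e G" for G :: "'a poly3"
    using that by (simp add: homogeneous_iff_grade flip: monom_0 add: mult_monom)
  have "grade (subst3 F A B C) =
      eval3 (\<lambda>c. grade (const3 c)) (grade A) (grade B) (grade C) F"
    by (rule hom_subst3[OF comm_ring_hom_grade])
  also have "\<dots> = monom 1 e ^ d * eval3 (\<lambda>c. [:const3 c:]) [:A:] [:B:] [:C:] F"
    unfolding grade_const3 m[OF assms(2)] m[OF assms(3)] m[OF assms(4)]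
    by (rule eval3_scale[OF F comm_ring_hom_const_const3])
  also have "eval3 (\<lambda>c. [:const3 c:]) [:A:] [:B:] [:C:] F = [:subst3 F A B C:]"
    by (rule hom_subst3[OF comm_ring_hom_const_poly, symmetric])
  finally show ?thesis
    by (simp add: homogeneous_iff_grade monom_power smult_monom mult.commute)
qed

section \<open>Triples, rescaling and composition\<close>

fun scale_triple :: "'a::comm_ring_1 poly3 \<Rightarrow> 'a triple \<Rightarrow> 'a triple" where
  "scale_triple S (F0, F1, F2) = (S * F0, S * F1, S * F2)"

lemma scale_triple_scale_triple: "scale_triple S (scale_triple T F) = scale_triple (S * T) F"
  by (cases F) (simp add: mult.assoc)

lemma same_map_scale_triple: "same_map G (scale_triple S G)"
  by (cases G) (simp add: algebra_simps)

text \<open>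
  A common factor of the outer triple contributes its own substitution instance to the composite,
  whereas one of the inner triple contributes its \<open>d\<close>-th power, \<open>d\<close> being the degree of the outer
  triple.
\<close>

lemma comp_map_scale_left:
  "comp_map (scale_triple S F) (G0, G1, G2) =
     scale_triple (subst3 S G0 G1 G2) (comp_map F (G0, G1, G2))"
proof -
  interpret e: comm_ring_hom "eval3 const3 G0 G1 G2"
    by (rule comm_ring_hom_eval3[OF comm_ring_hom_const3])
  show ?thesis by (cases F) (simp add: subst3_eq_eval3 e.hom_mult)
qed

lemma comp_map_scale_right:
  assumes "homogeneous_triple d F"
  shows "comp_map F (scale_triple S G) = scale_triple (S ^ d) (comp_map F G)"
  using assms
  by (cases F; cases G) (simp add: subst3_eq_eval3 eval3_scale comm_ring_hom_const3)

lemma comp_map_assoc: "comp_map (comp_map F G) H = comp_map F (comp_map G H)"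
proof -
  obtain F0 F1 F2 G0 G1 G2 H0 H1 H2
    where FGH: "F = (F0, F1, F2)" "G = (G0, G1, G2)" "H = (H0, H1, H2)"
    by (cases F; cases G; cases H) blast
  have "comm_ring_hom (\<lambda>P. subst3 P H0 H1 H2)"
    unfolding subst3_eq_eval3 by (rule comm_ring_hom_eval3[OF comm_ring_hom_const3])
  from hom_subst3[OF this] show ?thesis
    by (simp add: FGH) (simp add: subst3_eq_eval3 eval3_const_var comm_ring_hom_const3)
qed

lemma comp_map_id_left: "comp_map id_map F = F"
  by (cases F) (simp add: id_map_def subst3_eq_eval3 eval3_const_var comm_ring_hom_const3)

lemma iter_map_0: "iter_map 0 F = id_map"
  and iter_map_Suc: "iter_map (Suc n) F = comp_map F (iter_map n F)"
  by (simp_all add: iter_map_def)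

lemma iter_map_add: "iter_map (m + n) F = comp_map (iter_map m F) (iter_map n F)"
  by (induction m) (simp_all add: iter_map_0 iter_map_Suc comp_map_id_left comp_map_assoc)

lemma homogeneous_triple_comp:
  assumes "homogeneous_triple d F" and "homogeneous_triple e G"
    and "comp_map F G \<noteq> (0, 0, 0)"
  shows "homogeneous_triple (d * e) (comp_map F G)"
  using assms by (cases F; cases G) (auto intro: homogeneous_subst3)

section \<open>Reduced triples and the degree of a rational map\<close>

text \<open>
  A homogeneous triple stays homogeneous after cancelling a common factor. A nonzero component fixes
  the degree of \<open>D\<close>, and the remaining components must agree with it.
\<close>

lemma homogeneous_triple_descend:
  fixes F :: "'a :: idom triple"
  assumes "homogeneous_triple d (scale_triple D F)"
  shows "\<exists>a b. homogeneous a D \<and> homogeneous_triple b F \<and> a + b = d"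
proof -
  obtain F0 F1 F2 where F: "F = (F0, F1, F2)" by (cases F)
  have h: "homogeneous d (D * P)" if "P \<in> {F0, F1, F2}" for P
    using assms that by (auto simp: F)
  obtain P where P: "P \<in> {F0, F1, F2}" "D * P \<noteq> 0" using assms by (auto simp: F)
  obtain a b where ab: "homogeneous a D" "a + b = d"
    using homogeneous_factors[OF h[OF P(1)] P(2)] by blast
  have "homogeneous b Q" if Q: "Q \<in> {F0, F1, F2}" for Q
  proof (cases "Q = 0")
    case False
    with P have "D * Q \<noteq> 0" by auto
    from homogeneous_factors[OF h[OF Q] this] obtain a' b'
      where *: "homogeneous a' D" "homogeneous b' Q" "a' + b' = d" by blast
    have "a' = a" using homogeneous_degree_unique[OF *(1) ab(1)] P by auto
    with * ab show ?thesis by auto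
  qed simp
  moreover have "F \<noteq> (0, 0, 0)" using P by (auto simp: F)
  ultimately have "homogeneous_triple b F" by (simp add: F)
  with ab show ?thesis by blast
qed

text \<open>
  Cancelling a common non-unit factor lowers the degree, because a homogeneous polynomial of degree 0
  over a field is a unit; so the process stops at a triple without common factor.
\<close>

lemma ex_reduced_triple:
  fixes F :: "'a :: field triple"
  assumes "homogeneous_triple d F"
  shows "\<exists>T G e. F = scale_triple T G \<and> homogeneous_triple e G \<and> no_common_factor G \<and> e \<le> d"
  using assms
proof (induction d arbitrary: F rule: less_induct)
  case (less d)
  show ?case
  proof (cases "no_common_factor F")
    case True
    have "F = scale_triple 1 F" by (cases F) simp
    with True less.prems show ?thesis by blast
  next
    case False
    obtain F0 F1 F2 where F012: "F = (F0, F1, F2)" by (cases F)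
    with False obtain D where D: "\<not> D dvd 1" and "D dvd F0" "D dvd F1" "D dvd F2" by auto
    then obtain G0 G1 G2 where "F0 = D * G0" "F1 = D * G1" "F2 = D * G2" by (elim dvdE)
    then obtain F' where F: "F = scale_triple D F'"
      using F012 scale_triple.simps[of D G0 G1 G2] by metis
    obtain a b where ab: "homogeneous a D" "homogeneous_triple b F'" "a + b = d"
      using homogeneous_triple_descend less.prems F by blast
    have "D \<noteq> 0" using less.prems by (cases F') (auto simp: F)
    with homogeneous_0_dvd_1[of D] ab(1) D have "a \<noteq> 0" by metis
    with ab have "b < d" by auto
    from less.IH[OF this ab(2)] show ?thesis
      using \<open>b < d\<close> unfolding F by (metis scale_triple_scale_triple less_imp_le order_trans)
  qed
qed

lemma same_map_trans:
  fixes F :: "'a :: idom triple"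
  assumes "same_map G F" and "same_map H F" and "F \<noteq> (0, 0, 0)"
  shows "same_map G H"
proof -
  obtain F0 F1 F2 G0 G1 G2 H0 H1 H2
    where FGH: "F = (F0, F1, F2)" "G = (G0, G1, G2)" "H = (H0, H1, H2)"
    by (cases F; cases G; cases H) blast
  have *: "A * D = B * C" if "A * P = Q * E" "B * P = R * E" "C * P = Q * K" "D * P = R * K" "P \<noteq> 0"
    for A B C D E K P Q R :: "'a poly3"
  proof -
    have "(P * P) * (A * D) = (A * P) * (D * P)" by (simp add: algebra_simps)
    also have "\<dots> = (B * P) * (C * P)" by (simp add: that algebra_simps)
    also have "\<dots> = (P * P) * (B * C)" by (simp add: algebra_simps)
    finally show ?thesis using that(5) by simp
  qed
  have **: "same_map G H"
    if "G0 * P = F0 * U" "G1 * P = F1 * U" "G2 * P = F2 * U"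
      "H0 * P = F0 * V" "H1 * P = F1 * V" "H2 * P = F2 * V" "P \<noteq> 0" for P U V
    unfolding FGH same_map.simps
    using *[OF that(1,2,4,5,7)] *[OF that(1,3,4,6,7)] *[OF that(2,3,5,6,7)] by blast
  note eqs = assms(1,2)[unfolded FGH same_map.simps]
  consider "F0 \<noteq> 0" | "F1 \<noteq> 0" | "F2 \<noteq> 0" using assms(3) by (auto simp: FGH)
  then show ?thesis
  proof cases
    case 1 show ?thesis by (rule **[of F0 G0 H0]) (use eqs 1 in \<open>metis mult.commute\<close>)+
  next
    case 2 show ?thesis by (rule **[of F1 G1 H1]) (use eqs 2 in \<open>metis mult.commute\<close>)+
  next
    case 3 show ?thesis by (rule **[of F2 G2 H2]) (use eqs 3 in \<open>metis mult.commute\<close>)+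
  qed
qed

lemma same_map_sym: "same_map F G \<Longrightarrow> same_map G F"
  by (cases F; cases G) (simp, metis mult.commute)

text \<open>
  By the two cross relations \<open>g0\<close> divides \<open>h0 * g0\<close>, \<open>h0 * g1\<close> and \<open>h0 * g2\<close>, hence also \<open>h0\<close>
  times the greatest common divisor of \<open>g0\<close>, \<open>g1\<close>, \<open>g2\<close>, which is a unit.
\<close>

lemma coprime_cross_dvd:
  fixes g0 g1 g2 h0 h1 h2 :: "'a :: semiring_gcd"
  assumes "\<And>d. d dvd g0 \<Longrightarrow> d dvd g1 \<Longrightarrow> d dvd g2 \<Longrightarrow> d dvd 1"
    and "g0 * h1 = g1 * h0" and "g0 * h2 = g2 * h0"
  shows "g0 dvd h0"
proof -
  have u: "gcd g0 (gcd g1 g2) dvd 1"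
    by (rule assms(1)) (auto intro: gcd_dvd1 dvd_trans[OF gcd_dvd2])
  have "g0 dvd gcd (h0 * g0) (gcd (h0 * g1) (h0 * g2))"
    using assms(2,3) by (intro gcd_greatest) (metis dvd_triv_left mult.commute)+
  then have "g0 dvd h0 * gcd g0 (gcd g1 g2)"
    by (simp add: gcd_mult_left)
  then show ?thesis using u by (simp add: dvd_mult_unit_iff)
qed

lemma reduced_dvd:
  fixes G0 :: "'a :: {field, factorial_ring_gcd, semiring_gcd_mult_normalize} poly3"
  assumes "no_common_factor (G0, G1, G2)" and "same_map (G0, G1, G2) (H0, H1, H2)"
  shows "G0 dvd H0 \<and> G1 dvd H1 \<and> G2 dvd H2"
proof -
  have c: "D dvd 1" if "D dvd G0" "D dvd G1" "D dvd G2" for D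
    using assms(1) that by simp
  have e: "G0 * H1 = G1 * H0" "G0 * H2 = G2 * H0" "G1 * H2 = G2 * H1"
    using assms(2) by simp_all
  show ?thesis
    using coprime_cross_dvd[of G0 G1 G2, OF c e(1,2)]
      coprime_cross_dvd[of G1 G0 G2, OF c e(1)[symmetric] e(3)]
      coprime_cross_dvd[of G2 G0 G1, OF c e(2,3)[symmetric]]
    by blast
qed

text \<open>
  Corresponding components of two reduced representatives divide each other, and associated
  homogeneous polynomials have the same degree. This is what makes the definite description
  in \<open>deg_map\<close> meaningful.
\<close>

lemma reduced_degree_unique:
  fixes G H :: "'a :: {field, factorial_ring_gcd, semiring_gcd_mult_normalize} triple"
  assumes G: "homogeneous_triple d G" "no_common_factor G"
    and H: "homogeneous_triple e H" "no_common_factor H"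
    and GH: "same_map G H"
  shows "d = e"
proof -
  have *: "d = e" if gh: "g dvd h" "h dvd g" "homogeneous d g" "homogeneous e h" "g \<noteq> 0"
    for g h :: "'a poly3"
  proof -
    obtain u where u: "u dvd 1" "h = u * g"
      using gh(1,2,5) by (metis dvdE dvd_times_left_cancel_iff mult.commute mult_1_right)
    have "homogeneous d h" using homogeneous_mult[OF homogeneous_unit[OF u(1)] gh(3)] u(2) by simp
    moreover have "h \<noteq> 0" using gh by auto
    ultimately show ?thesis using homogeneous_degree_unique gh(4) by blast
  qed
  obtain G0 G1 G2 H0 H1 H2 where GH_eq: "G = (G0, G1, G2)" "H = (H0, H1, H2)"
    by (cases G; cases H) blast
  have "G0 dvd H0 \<and> G1 dvd H1 \<and> G2 dvd H2" "H0 dvd G0 \<and> H1 dvd G1 \<and> H2 dvd G2"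
    using reduced_dvd G(2) H(2) GH same_map_sym[OF GH] unfolding GH_eq by blast+
  then show ?thesis
    using * G(1) H(1) by (auto simp: GH_eq)
qed

lemma deg_map_eqI:
  fixes F G :: "'a :: {field, factorial_ring_gcd, semiring_gcd_mult_normalize} triple"
  assumes "homogeneous_triple d G" and "no_common_factor G" and "same_map G F"
    and "F \<noteq> (0, 0, 0)"
  shows "deg_map F = d"
  unfolding deg_map_def
  using assms reduced_degree_unique same_map_trans by (intro the_equality) blast+

lemma deg_map_scale_triple_le:
  fixes F :: "'a :: {field, factorial_ring_gcd, semiring_gcd_mult_normalize} triple"
  assumes "homogeneous_triple d F" and "S \<noteq> 0"
  shows "deg_map (scale_triple S F) \<le> d"
proof -
  obtain T G e where G: "F = scale_triple T G" "homogeneous_triple e G" "no_common_factor G" "e \<le> d"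
    using ex_reduced_triple[OF assms(1)] by blast
  have "scale_triple S F \<noteq> (0, 0, 0)" using assms by (cases F) auto
  moreover have "same_map G (scale_triple S F)"
    by (simp add: G(1) scale_triple_scale_triple same_map_scale_triple)
  ultimately have "deg_map (scale_triple S F) = e" using deg_map_eqI G(2,3) by blast
  with G(4) show ?thesis by simp
qed

text \<open>
  If $F = S h$ and $G = T g$ with \<open>h\<close>, \<open>g\<close> reduced, then $F \circ G = S(G)\, T^a\, (h \circ g)$ where
  \<open>a\<close> is the degree of \<open>h\<close>. Since the composite is not the zero triple, neither is $h \circ g$, which
  is homogeneous of the product degree. Writing \<open>F\<close> as a multiple of \<open>h\<close>, rather than merely
  proportional to it, avoids having to know that \<open>G\<close> is dominant.
\<close>

lemma deg_map_comp_le: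
  fixes F G :: "'a :: {field, factorial_ring_gcd, semiring_gcd_mult_normalize} triple"
  assumes "homogeneous_triple d F" and "homogeneous_triple e G" and nz: "comp_map F G \<noteq> (0, 0, 0)"
  shows "deg_map (comp_map F G) \<le> deg_map F * deg_map G"
proof -
  obtain S h a where h: "F = scale_triple S h" "homogeneous_triple a h" "no_common_factor h"
    using ex_reduced_triple[OF assms(1)] by blast
  obtain T g b where g: "G = scale_triple T g" "homogeneous_triple b g" "no_common_factor g"
    using ex_reduced_triple[OF assms(2)] by blast
  have "F \<noteq> (0, 0, 0)" "G \<noteq> (0, 0, 0)" using assms by (cases F; cases G; auto)+
  then have deg: "deg_map F = a" "deg_map G = b"
    using deg_map_eqI h(2,3) g(2,3) same_map_scale_triple unfolding h(1) g(1) by blast+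
  obtain G0 G1 G2 where G: "G = (G0, G1, G2)" by (cases G)
  define R where "R = subst3 S G0 G1 G2 * T ^ a"
  have eq: "comp_map F G = scale_triple R (comp_map h g)"
    unfolding R_def h(1) using comp_map_scale_left[of S h G0 G1 G2] comp_map_scale_right[OF h(2), of T g]
    by (simp add: G[symmetric] g(1)[symmetric] scale_triple_scale_triple)
  have "R \<noteq> 0" "comp_map h g \<noteq> (0, 0, 0)"
    using nz unfolding eq by (cases "comp_map h g"; auto)+
  then show ?thesis
    using deg_map_scale_triple_le[OF homogeneous_triple_comp[OF h(2) g(2)]] by (simp add: eq deg)
qed

section \<open>Roots of submultiplicative sequences\<close>

text \<open>
  Fekete's lemma. For positive terms the logarithms $b_n = \ln(a_n) / n$ satisfy
  $b_n \le b_N + O(1/n)$ for each \<open>N\<close>, by dividing \<open>n\<close> by \<open>N\<close> with remainder; so $b_n$ tends to its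
  infimum. If some term vanishes, all later ones do, and the limit is 0.
\<close>

lemma fekete_submultiplicative:
  fixes a :: "nat \<Rightarrow> nat"
  assumes sub: "\<And>m n. a (m + n) \<le> a m * a n"
  shows "\<exists>L. (\<lambda>n. real (a n) powr (1 / real n)) \<longlonglongrightarrow> L \<and>
             (\<forall>N\<ge>1. L \<le> real (a N) powr (1 / real N))"
proof (cases "\<exists>N. a N = 0")
  case True
  then obtain N where N: "a N = 0" by blast
  have "a n = 0" if "n \<ge> N" for n
    using sub[of N "n - N"] N that by simp
  then have "eventually (\<lambda>n. real (a n) powr (1 / real n) = 0) sequentially"
    by (intro eventually_sequentiallyI[of N]) simp
  then show ?thesis
    by (intro exI[of _ 0]) (simp add: tendsto_eventually)
next
  case False
  then have pos: "a n \<ge> 1" for n by (simp add: Suc_le_eq)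
  define b where "b = (\<lambda>n. ln (real (a n)) / real n)"
  have b_nonneg: "0 \<le> b n" for n using pos[of n] by (simp add: b_def)
  define L where "L = Inf (b ` {1..})"
  have bdd: "bdd_below (b ` {1..})" using b_nonneg by (intro bdd_belowI[of _ 0]) auto
  have L_le: "L \<le> b n" if "n \<ge> 1" for n
    unfolding L_def using that by (intro cInf_lower bdd) auto
  \<comment> \<open>The constant is the logarithm of a bound for the terms indexed by the possible remainders.\<close>
  have rem: "\<exists>C. \<forall>n\<ge>1. b n \<le> b N + C / real n" if N: "N \<ge> 1" for N
  proof -
    define M where "M = (\<Sum>r<N. a r)"
    have pow: "a (k * N + r) \<le> a N ^ k * a r" for k r
    proof (induction k)
      case (Suc k)
      have "a (Suc k * N + r) \<le> a N * a (k * N + r)"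
        using sub[of N "k * N + r"] by (simp add: add.assoc)
      also have "\<dots> \<le> a N * (a N ^ k * a r)" by (intro mult_left_mono Suc.IH) simp
      finally show ?case by (simp add: mult.assoc)
    qed simp
    have "b n \<le> b N + ln (real M) / real n" if n: "n \<ge> 1" for n
    proof -
      define k where "k = n div N"
      have aM: "a (n mod N) \<le> M"
        unfolding M_def using N by (intro member_le_sum) auto
      have M: "M \<ge> 1" using aM pos[of "n mod N"] by linarith
      have "a n \<le> a N ^ k * a (n mod N)"
        using pow[of k "n mod N"] by (simp add: k_def)
      also have "\<dots> \<le> a N ^ k * M" using aM by simp
      finally have "real (a n) \<le> real (a N) ^ k * real M"
        by (metis of_nat_le_iff of_nat_mult of_nat_power)
      then have "ln (real (a n)) \<le> ln (real (a N) ^ k * real M)"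
        using pos[of n] by (subst ln_le_cancel_iff) (use pos[of N] M in auto)
      also have "\<dots> = real k * ln (real (a N)) + ln (real M)"
        using pos[of N] M by (simp add: ln_mult ln_realpow)
      also have "real k * ln (real (a N)) \<le> (real n / real N) * ln (real (a N))"
        using pos[of N] by (intro mult_right_mono) (simp_all add: k_def of_nat_div_le_of_nat)
      finally have "ln (real (a n)) \<le> (real n / real N) * ln (real (a N)) + ln (real M)" by simp
      then have "ln (real (a n)) / real n
          \<le> ((real n / real N) * ln (real (a N)) + ln (real M)) / real n"
        by (rule divide_right_mono) simp
      also have "\<dots> = b N + ln (real M) / real n" using n by (simp add: b_def add_divide_distrib)
      finally show ?thesis by (simp add: b_def)
    qed
    then show ?thesis by blast
  qed
  have "b \<longlonglongrightarrow> L"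
  proof (rule LIMSEQ_I)
    fix e :: real assume e: "e > 0"
    have "Inf (b ` {1..}) < L + e / 2" using e by (simp add: L_def)
    then obtain N where N: "N \<ge> 1" "b N < L + e / 2"
      using cInf_lessD[of "b ` {1..}" "L + e / 2"] by auto
    obtain C where C: "\<And>n. n \<ge> 1 \<Longrightarrow> b n \<le> b N + C / real n" using rem[OF N(1)] by blast
    have "(\<lambda>n. C / real n) \<longlonglongrightarrow> 0" by (rule lim_const_over_n)
    then have "eventually (\<lambda>n. C / real n < e / 2) sequentially"
      using e by (intro order_tendstoD(2)) auto
    then obtain n0 where n0: "\<And>n. n \<ge> n0 \<Longrightarrow> C / real n < e / 2"
      by (auto simp: eventually_sequentially)
    have "norm (b n - L) < e" if "n \<ge> max 1 n0" for n
    proof -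
      have "b n \<le> b N + C / real n" "C / real n < e / 2" using C n0 that by auto
      then have "b n < L + e" using N(2) by linarith
      moreover have "L \<le> b n" using L_le[of n] that by simp
      ultimately show ?thesis using e by simp
    qed
    then show "\<exists>no. \<forall>n\<ge>no. norm (b n - L) < e" by blast
  qed
  then have "(\<lambda>n. exp (b n)) \<longlonglongrightarrow> exp L" by (intro tendsto_intros)
  moreover have exp_b: "exp (b n) = real (a n) powr (1 / real n)" for n
    using pos[of n] by (simp add: b_def powr_def)
  moreover have "exp L \<le> real (a N) powr (1 / real N)" if "N \<ge> 1" for N
    using L_le[OF that] by (simp flip: exp_b)
  ultimately show ?thesis by (intro exI[of _ "exp L"]) simp
qed

section \<open>The map and its iterates\<close>

lemma comm_ring_hom_base_change3: "comm_ring_hom (base_change3 :: int poly3 \<Rightarrow> 'a::comm_ring_1 poly3)"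
proof -
  interpret h1: map_poly_comm_ring_hom "of_int :: int \<Rightarrow> 'a" ..
  interpret h2: map_poly_comm_ring_hom "map_poly (of_int :: int \<Rightarrow> 'a)" ..
  interpret h3: map_poly_comm_ring_hom "map_poly (map_poly (of_int :: int \<Rightarrow> 'a))" ..
  show ?thesis unfolding base_change3_def by (rule h3.comm_ring_hom_axioms)
qed

lemma base_change_f_map:
  "(base_change f_map :: 'a::comm_ring_1 triple) =
     (var_x * var_y, var_x * var_y - 2 * var_z ^ 2, var_y * var_z + 3 * var_z ^ 2)"
proof -
  interpret b: comm_ring_hom "base_change3 :: _ \<Rightarrow> 'a poly3" by (rule comm_ring_hom_base_change3)
  have "base_change3 var_x = (var_x :: 'a poly3)" "base_change3 var_y = (var_y :: 'a poly3)"
    "base_change3 var_z = (var_z :: 'a poly3)"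
    by (simp_all add: base_change3_def var_x_def var_y_def var_z_def map_poly_pCons)
  then show ?thesis
    by (simp add: f_map_def b.hom_add b.hom_minus b.hom_mult b.hom_power b.hom_numeral)
qed

lemma comp_map_f:
  "comp_map (base_change f_map) (A, B, C) = (A * B, A * B - 2 * C ^ 2, B * C + 3 * C ^ 2)"
proof -
  interpret e: comm_ring_hom "eval3 const3 A B C"
    by (rule comm_ring_hom_eval3[OF comm_ring_hom_const3])
  show ?thesis
    by (simp add: base_change_f_map subst3_eq_eval3 e.hom_add e.hom_minus e.hom_mult e.hom_power
        e.hom_numeral eval3_const_var comm_ring_hom_const3)
qed

lemma comm_ring_hom_ident: "comm_ring_hom (\<lambda>c :: 'a :: comm_ring_1. c)"
  by unfold_locales simp_all

text \<open>
  In the chart $z = 1$ the map is $[U : V : W] = [xy : xy - 2 : y + 3]$, so $U - V$ equals 2 times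
  the scaling factor; this gives $y = 2 W / (U - V) - 3$ and then $x = 2 U / ((U - V) y)$. Clearing
  denominators yields the triple below.
\<close>

definition f_inverse :: "'a::comm_ring_1 triple" where
  "f_inverse =
     (2 * var_x * (var_x - var_y), (2 * var_z - 3 * (var_x - var_y)) ^ 2,
      (var_x - var_y) * (2 * var_z - 3 * (var_x - var_y)))"

lemma comp_map_f_inverse:
  "comp_map f_inverse (A, B, C) =
     (2 * A * (A - B), (2 * C - 3 * (A - B)) ^ 2, (A - B) * (2 * C - 3 * (A - B)))"
proof -
  interpret e: comm_ring_hom "eval3 const3 A B C"
    by (rule comm_ring_hom_eval3[OF comm_ring_hom_const3])
  show ?thesis
    by (simp add: f_inverse_def subst3_eq_eval3 e.hom_add e.hom_minus e.hom_mult e.hom_power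
        e.hom_numeral eval3_const_var comm_ring_hom_const3)
qed

lemma homogeneous_triple_f:
  "homogeneous_triple 2 (base_change f_map :: 'a::idom triple)"
proof -
  note h = homogeneous_mult[of 1 _ 1 _, OF homogeneous_var(1) homogeneous_var(2)]
    homogeneous_mult[of 1 _ 1 _, OF homogeneous_var(2) homogeneous_var(3)]
    homogeneous_power[of 1 _ 2, OF homogeneous_var(3)]
  have "homogeneous 2 (var_x * var_y :: 'a poly3)" "homogeneous 2 (var_y * var_z :: 'a poly3)"
     "homogeneous 2 (numeral n * var_z ^ 2 :: 'a poly3)" for n
    using h homogeneous_mult[OF homogeneous_numeral h(3), of n] by (simp_all add: numeral_2_eq_2)
  moreover have "var_x * var_y \<noteq> (0 :: 'a poly3)" by (simp add: var_x_def var_y_def)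
  ultimately show ?thesis
    by (simp add: base_change_f_map homogeneous_add homogeneous_diff)
qed

text \<open>
  Evaluate at $(1, 1, 0)$, which every iterate maps to itself, already at the level of the affine
  triples.
\<close>

lemma iter_map_f_nonzero:
  "iter_map n (base_change f_map :: 'a::field triple) \<noteq> (0, 0, 0)"
proof -
  let ?e = "eval3 (\<lambda>c :: 'a. c) 1 1 0"
  interpret e: comm_ring_hom ?e by (rule comm_ring_hom_eval3[OF comm_ring_hom_ident])
  have "\<exists>A B C. iter_map n (base_change f_map) = (A, B, C) \<and> ?e A = 1 \<and> ?e B = 1 \<and> ?e C = 0"
  proof (induction n)
    case 0
    show ?case by (simp add: iter_map_0 id_map_def eval3_const_var comm_ring_hom_ident)
  next
    case (Suc n)
    then show ?case
      by (auto simp: iter_map_Suc comp_map_f e.hom_add e.hom_minus e.hom_mult e.hom_power)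
  qed
  then show ?thesis by auto
qed

lemma homogeneous_triple_iter_f:
  "homogeneous_triple (2 ^ n) (iter_map n (base_change f_map :: 'a::field triple))"
proof (induction n)
  case 0
  have "var_x \<noteq> (0 :: 'a poly3)" by (simp add: var_x_def)
  then show ?case using homogeneous_var by (simp add: iter_map_0 id_map_def)
next
  case (Suc n)
  show ?case
    using homogeneous_triple_comp[OF homogeneous_triple_f Suc.IH] iter_map_f_nonzero[of "Suc n"]
    by (simp add: iter_map_Suc)
qed

text \<open>
  Both composites are multiples of the identity; it remains to see that the multipliers, and the
  inverse itself, are not zero. This is checked at a point.
\<close>

lemma birational_map_f:
  assumes two: "(2 :: 'a :: field) \<noteq> 0"
  shows "birational_map (base_change f_map :: 'a triple)"
proof -
  let ?f = "base_change f_map :: 'a triple" and ?g = "f_inverse :: 'a triple"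
  let ?u = "var_x - var_y :: 'a poly3" and ?w = "2 * var_z - 3 * (var_x - var_y) :: 'a poly3"
  have fg: "comp_map ?f ?g = scale_triple (2 * ?u * ?w ^ 2) id_map"
    unfolding f_inverse_def comp_map_f id_map_def scale_triple.simps prod.inject
    by (simp add: algebra_simps power2_eq_square)
  have gf: "comp_map ?g ?f = scale_triple (4 * var_y * var_z ^ 2) id_map"
    unfolding base_change_f_map comp_map_f_inverse id_map_def scale_triple.simps prod.inject
    by (simp add: algebra_simps power2_eq_square)
  have f: "homogeneous_triple 2 ?f" by (rule homogeneous_triple_f)
  \<comment> \<open>At $(1, 0, 2)$ both \<open>?u\<close> and \<open>?w\<close> take the value 1, and at $(0, 1, 1)$ both \<open>y\<close> and \<open>z\<close> do, so
    only powers of 2 remain.\<close>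
  let ?p = "eval3 (\<lambda>c :: 'a. c) 1 0 2" and ?q = "eval3 (\<lambda>c :: 'a. c) 0 1 1"
  interpret p: comm_ring_hom ?p by (rule comm_ring_hom_eval3[OF comm_ring_hom_ident])
  interpret q: comm_ring_hom ?q by (rule comm_ring_hom_eval3[OF comm_ring_hom_ident])
  note ev = p.hom_add p.hom_minus p.hom_mult p.hom_power p.hom_numeral
     q.hom_add q.hom_minus q.hom_mult q.hom_power q.hom_numeral eval3_const_var comm_ring_hom_ident
  have "?p (2 * var_x * ?u) \<noteq> 0" using two by (simp add: ev)
  then have "2 * var_x * ?u \<noteq> 0" by (metis p.hom_zero)
  have u: "homogeneous 1 ?u" by (intro homogeneous_diff homogeneous_var)
  have w: "homogeneous 1 ?w"
    using homogeneous_diff[OF homogeneous_mult[OF homogeneous_numeral homogeneous_var(3)]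
      homogeneous_mult[OF homogeneous_numeral u]] by simp
  have "homogeneous 2 (2 * var_x * ?u)"
    using homogeneous_mult[OF homogeneous_mult[OF homogeneous_numeral homogeneous_var(1)] u]
    by (simp add: numeral_2_eq_2)
  moreover have "homogeneous 2 (?w ^ 2)" using homogeneous_power[OF w, of 2] by simp
  moreover have "homogeneous 2 (?u * ?w)" using homogeneous_mult[OF u w] by (simp add: numeral_2_eq_2)
  ultimately have g: "homogeneous_triple 2 ?g"
    using \<open>2 * var_x * ?u \<noteq> 0\<close> by (simp add: f_inverse_def)
  have "?p (2 * ?u * ?w ^ 2 * var_x) \<noteq> 0" using two by (simp add: ev)
  then have "2 * ?u * ?w ^ 2 * var_x \<noteq> 0" by (metis p.hom_zero)
  then have "comp_map ?f ?g \<noteq> (0, 0, 0)" by (simp add: fg id_map_def)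
  from homogeneous_triple_comp[OF f g this] have 1: "rational_map (comp_map ?f ?g)"
    unfolding rational_map_def by blast
  have "(4 :: 'a) = 2 * 2" by simp
  then have "(4 :: 'a) \<noteq> 0" using two by (metis mult_eq_0_iff)
  then have "?q (4 * var_y * var_z ^ 2 * var_y) \<noteq> 0" by (simp add: ev)
  then have "4 * var_y * var_z ^ 2 * var_y \<noteq> (0 :: 'a poly3)" by (metis q.hom_zero)
  then have "comp_map ?g ?f \<noteq> (0, 0, 0)" by (simp add: gf id_map_def)
  from homogeneous_triple_comp[OF g f this] have 2: "rational_map (comp_map ?g ?f)"
    unfolding rational_map_def by blast
  have "same_map (comp_map ?f ?g) id_map" "same_map (comp_map ?g ?f) id_map"
    unfolding fg gf by (rule same_map_sym[OF same_map_scale_triple])+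
  with f g 1 2 show ?thesis unfolding birational_map_def rational_map_def by blast
qed

text \<open>
  The orbit of the contracted line $y = 0$, expressed by congruences modulo \<open>y\<close>. From
  $[y_n, z_n] = [-2 (2^n - 1) D, (2^{n+1} - 1) D]$ and $x_n y_n = 0$ one gets
  $y_{n+1} = -2 z_n^2$ and $z_{n+1} = z_n (y_n + 3 z_n)$, which has the same shape with \<open>D\<close> replaced
  by $(2^{n+1} - 1) D^2$. Only the product $x_n y_n$ enters, and it is divisible by \<open>y\<close> from
  $n = 0$ on, while $x_n$ itself is divisible only for $n \ge 1$.
\<close>

lemma iter_map_f_mod_y:
  "\<exists>A B C D. iter_map n (base_change f_map :: 'a::field triple) = (A, B, C) \<and>
     var_y dvd A * B \<and> var_y dvd B + 2 * (2 ^ n - 1) * D \<and> var_y dvd C - (2 ^ Suc n - 1) * D"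
proof (induction n)
  case 0
  have "iter_map 0 (base_change f_map :: 'a triple) = (var_x, var_y, var_z)"
    by (simp add: iter_map_0 id_map_def)
  moreover have "var_y dvd var_y + 2 * (2 ^ 0 - 1) * (var_z :: 'a poly3)"
    and "var_y dvd var_z - (2 ^ Suc 0 - 1) * (var_z :: 'a poly3)" by simp_all
  ultimately show ?case by (meson dvd_triv_right)
next
  case (Suc n)
  then obtain A B C D where it: "iter_map n (base_change f_map :: 'a triple) = (A, B, C)"
    and dvd: "var_y dvd A * B" "var_y dvd B + 2 * (2 ^ n - 1) * D" "var_y dvd C - (2 ^ Suc n - 1) * D"
    by blast
  from dvd obtain k l m where IH: "A * B = var_y * k" "B + 2 * (2 ^ n - 1) * D = var_y * l"
    "C - (2 ^ Suc n - 1) * D = var_y * m"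
    by (elim dvdE)
  define t :: "'a poly3" where "t = 2 ^ n"
  have B: "B = var_y * l - 2 * (t - 1) * D" and C: "C = var_y * m + (2 * t - 1) * D"
    using IH(2,3) by (simp_all add: t_def algebra_simps)
  let ?B = "A * B - 2 * C ^ 2" and ?C = "B * C + 3 * C ^ 2" and ?D = "(2 * t - 1) * D ^ 2"
  have "?B + 2 * (2 * t - 1) * ?D = var_y * (k - 2 * m * (C + (2 * t - 1) * D))"
    unfolding IH(1) unfolding C by (simp add: algebra_simps power2_eq_square)
  then have "var_y dvd ?B + 2 * (2 ^ Suc n - 1) * ?D" by (simp add: t_def)
  moreover have "?C - (4 * t - 1) * ?D =
      var_y * (m * (B + 3 * C) + (l + 3 * m) * ((2 * t - 1) * D))"
    unfolding B C by (simp add: algebra_simps power2_eq_square)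
  then have "var_y dvd ?C - (2 ^ Suc (Suc n) - 1) * ?D" by (simp add: t_def)
  moreover have "var_y dvd A * B * ?B" using dvd(1) by (rule dvd_mult2)
  moreover have "iter_map (Suc n) (base_change f_map) = (A * B, ?B, ?C)"
    by (simp add: iter_map_Suc it comp_map_f)
  ultimately show ?case by blast
qed

text \<open>
  Here the orbit of $y = 0$ hits the indeterminacy point $[0 : 1 : 0]$: when $2^{n+1} = 1$, the
  polynomial \<open>y\<close> divides $z_n$, besides $x_n y_n$, and all components of the next iterate lie in the
  ideal generated by these two.
\<close>

lemma deg_map_iter_f_less:
  fixes f :: "'a :: {field, factorial_ring_gcd, semiring_gcd_mult_normalize} triple"
  assumes f: "f = base_change f_map" and "(2 :: 'a) ^ Suc n = 1"
  shows "deg_map (iter_map (Suc n) f) < 2 ^ Suc n"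
proof -
  obtain A B C D where it: "iter_map n f = (A, B, C)" "var_y dvd A * B"
    "var_y dvd C - (2 ^ Suc n - 1) * D"
    unfolding f using iter_map_f_mod_y[of n] by blast
  interpret c: comm_ring_hom "const3 :: 'a \<Rightarrow> _" by (rule comm_ring_hom_const3)
  have "(2 :: 'a poly3) ^ Suc n = const3 (2 ^ Suc n)" by (simp only: c.hom_power c.hom_numeral)
  also have "\<dots> = 1" unfolding assms(2) by (rule c.hom_one)
  finally have "var_y dvd C" using it(3) by simp
  with it(2) obtain P Q where PQ: "A * B = var_y * P" "C = var_y * Q" by (elim dvdE)
  have eq: "iter_map (Suc n) f = scale_triple var_y (P, P - 2 * Q * C, B * Q + 3 * Q * C)"
    unfolding iter_map_Suc it(1) unfolding f comp_map_f
    by (simp add: PQ power2_eq_square algebra_simps)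
  from homogeneous_triple_iter_f[of "Suc n"] obtain a b
    where ab: "homogeneous a (var_y :: 'a poly3)"
      "homogeneous_triple b (P, P - 2 * Q * C, B * Q + 3 * Q * C)" "a + b = 2 ^ Suc n"
    using homogeneous_triple_descend eq f by metis
  have y: "var_y \<noteq> (0 :: 'a poly3)" by (simp add: var_y_def)
  have "a = 1" using homogeneous_degree_unique[OF ab(1) homogeneous_var(2) y] .
  with deg_map_scale_triple_le[OF ab(2) y] ab(3) show ?thesis by (simp add: eq)
qed

text \<open>
  The dynamical degree is the infimum of the roots of the degrees, so one drop in degree suffices.
\<close>

lemma dynamical_degree_f_less_2:
  fixes f :: "'a :: {field, factorial_ring_gcd, semiring_gcd_mult_normalize} triple"
  assumes f: "f = base_change f_map" and "(2 :: 'a) ^ Suc n = 1"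
  shows "convergent (deg_growth f) \<and> dynamical_degree f < 2"
proof -
  define a where "a = (\<lambda>n. deg_map (iter_map n f))"
  have "a (m + n) \<le> a m * a n" for m n
    unfolding a_def iter_map_add
    using homogeneous_triple_iter_f iter_map_f_nonzero[of "m + n"]
    unfolding f by (intro deg_map_comp_le) (auto simp: iter_map_add)
  from fekete_submultiplicative[OF this] obtain L
    where lim: "(\<lambda>n. real (a n) powr (1 / real n)) \<longlonglongrightarrow> L"
      and le: "\<forall>N\<ge>1. L \<le> real (a N) powr (1 / real N)"
    by blast
  have L: "deg_growth f \<longlonglongrightarrow> L" using lim by (simp add: a_def deg_growth_def[abs_def])
  have "real (a (Suc n)) < 2 ^ Suc n"
    using deg_map_iter_f_less[OF assms] unfolding a_def
    by (metis of_nat_less_iff of_nat_numeral of_nat_power)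
  then have "real (a (Suc n)) powr (1 / real (Suc n)) < (2 ^ Suc n) powr (1 / real (Suc n))"
    by (intro powr_less_mono2) auto
  also have "\<dots> = 2" by (simp add: powr_powr flip: powr_realpow del: power_Suc)
  finally have "L < 2" using le[rule_format, of "Suc n"] by simp
  moreover have "dynamical_degree f = L" using L by (simp add: dynamical_degree_def limI)
  ultimately show ?thesis using L by (auto simp: convergent_def)
qed

text \<open>
  The degree theory applies to the field at hand; existence of prime factorisations is vacuous in a
  field.
\<close>

instance alg_closure :: (field) factorial_ring_gcd ..

theorem proposition5p2:
  fixes p :: nat
  assumes "prime p" and "p > 2" and "CARD('p::prime_card) = p"
  shows "birational_map (base_change f_map :: rat triple) \<and>
         birational_map (f_red TYPE('p)) \<and>
         convergent (deg_growth (f_red TYPE('p))) \<and>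
         dynamical_degree (f_red TYPE('p)) < 2"
proof -
  have char: "CHAR('p mod_ring alg_closure) = p" using assms(3) by simp
  have "\<not> p dvd 2" using \<open>p > 2\<close> by (auto dest: dvd_imp_le)
  then have two: "(2 :: 'p mod_ring alg_closure) \<noteq> 0"
    using of_nat_eq_0_iff_char_dvd[of 2, where ?'a = "'p mod_ring alg_closure"] char by simp
  have "[2 ^ (p - 1) = 1] (mod p)"
    using fermat_theorem[OF \<open>prime p\<close>, of 2] \<open>\<not> p dvd 2\<close> by simp
  then have "(of_nat (2 ^ (p - 1)) :: 'p mod_ring alg_closure) = of_nat 1"
    by (simp only: of_nat_eq_iff_cong_CHAR char)
  then have "(2 :: 'p mod_ring alg_closure) ^ Suc (p - 2) = 1"
    using \<open>p > 2\<close> by (simp add: Suc_diff_Suc numeral_2_eq_2)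
  from dynamical_degree_f_less_2[OF refl this] show ?thesis
    unfolding f_red_def by (simp add: birational_map_f two)
qed

end
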